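(* For all real $a,b>0$ with $a\neq b$, writing $A,P,X$ for $A(a,b),P(a,b),X(a,b)$, one has $$(AX)^{1/\alpha_2}<P<\left(AX^{\beta_2}\right)^{1/(1+\beta_2)},$$ with best possible constants $\alpha_2=2$ and $\beta_2=\dfrac{\log(\pi/2)}{\log(2e/\pi)}\approx 0.8234$.
   Context: For real $a,b>0$ with $a\neq b$: $A(a,b)=\frac{a+b}{2}$, $G(a,b)=\sqrt{ab}$, $P(a,b)=\dfrac{a-b}{2\arcsin\left(\frac{a-b}{a+b}\right)}$ (Seiffert mean), and $X(a,b)=A\,e^{G/P-1}$. "Best possible" means: the left inequality does not hold for all $a,b>0$, $a\neq b$, if $\alpha_2=2$ is replaced by any other positive constant, and the right inequality does not hold for all $a,b>0$, $a\neq b$, if $\beta_2$ is replaced by any larger constant. *)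

theory Defs
  imports Complex_Main
begin

definition A_mean :: "real \<Rightarrow> real \<Rightarrow> real" where
  "A_mean a b = (a + b) / 2"

definition G_mean :: "real \<Rightarrow> real \<Rightarrow> real" where
  "G_mean a b = sqrt (a * b)"

(* First Seiffert mean, meant for a, b > 0 with a \<noteq> b; at a = b this formula gives 0 / 0 = 0. *)
definition P_mean :: "real \<Rightarrow> real \<Rightarrow> real" where
  "P_mean a b = (a - b) / (2 * arcsin ((a - b) / (a + b)))"

definition X_mean :: "real \<Rightarrow> real \<Rightarrow> real" where
  "X_mean a b = A_mean a b * exp (G_mean a b / P_mean a b - 1)"

definition alpha2 :: real where
  "alpha2 = 2"

definition beta2 :: real where
  "beta2 = ln (pi / 2) / ln (2 * exp 1 / pi)"

end

theory Submission
  imports Defs "HOL-Analysis.Analysis" "HOL-Real_Asymp.Real_Asymp"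
begin

text \<open>
  With \<open>t = arcsin (\<bar>a - b\<bar> / (a + b))\<close> in \<open>(0, \<pi>/2)\<close> one has \<open>P = A * exp (\<phi> t)\<close> and
  \<open>X = A * exp (\<psi> t)\<close>, where \<open>\<phi> t = ln (sin t / t)\<close> and \<open>\<psi> t = t * cot t - 1\<close>. Since
  \<open>\<beta>\<^sub>2 / (1 + \<beta>\<^sub>2) = L\<close> for \<open>L = ln (\<pi>/2)\<close>, the two inequalities become \<open>\<psi>/2 < \<phi> < L * \<psi>\<close>.
  The sign of the derivative of \<open>\<phi> - l * \<psi>\<close> is that of a function that vanishes at 0 together
  with its first derivative and whose second derivative has the sign of
  \<open>l * sin t - (1 - l) * t * cos t\<close>. For \<open>l = 1/2\<close> all these are positive. For \<open>l = L < 1/2\<close> each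
  changes sign at most once, from negative to positive, and \<open>\<phi> - L * \<psi>\<close> vanishes at
  \<open>\<pi>/2\<close>, so it is negative before. Sharpness of the left constant follows by scaling, because only
  for \<open>\<alpha> = 2\<close> are both sides homogeneous of the same degree; that of the right one from
  \<open>t \<rightarrow> \<pi>/2\<close>.
\<close>

section \<open>Passing signs from a derivative to its antiderivative\<close>

definition single_crossing :: "real \<Rightarrow> (real \<Rightarrow> real) \<Rightarrow> bool" where
  "single_crossing b F \<longleftrightarrow> (\<forall>x y. 0 < x \<and> x < y \<and> y \<le> b \<and> 0 \<le> F x \<longrightarrow> 0 < F y)"

text \<open>The condition at 0 is a limit because division by zero gives \<open>psi 0 = -1\<close>,
  whereas \<open>psi\<close> tends to 0 there. The limit yields only a weak inequality, so it is
  applied at x/2, and the strict increase from x/2 to x makes it strict.\<close>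

lemma pos_if_deriv_pos:
  fixes F :: "real \<Rightarrow> real"
  assumes lim: "(F \<longlongrightarrow> 0) (at_right 0)"
    and der: "\<And>x. 0 < x \<Longrightarrow> x \<le> b \<Longrightarrow> \<exists>D. (F has_real_derivative D) (at x) \<and> 0 < D"
    and x: "0 < x" "x \<le> b"
  shows "0 < F x"
proof -
  have mono: "F u < F v" if "0 < u" "u < v" "v \<le> x" for u v
    by (rule DERIV_pos_imp_increasing[OF \<open>u < v\<close>], rule der) (use that x in auto)
  have "eventually (\<lambda>w. w \<in> {0<..<x/2}) (at_right 0)"
    using x by (intro eventually_at_right_real) auto
  then have "eventually (\<lambda>w. F w \<le> F (x/2)) (at_right 0)"
    by eventually_elim (use x in \<open>auto intro!: less_imp_le[OF mono]\<close>)
  then have "0 \<le> F (x/2)"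
    by (intro tendsto_upperbound[OF lim]) auto
  also have "\<dots> < F x"
    by (rule mono) (use x in auto)
  finally show ?thesis .
qed

text \<open>If G were negative on all of (0, x], then F would decrease strictly from its limit 0 and
  F x would be negative. So F x \<ge> 0 forces G to be nonnegative somewhere up to x, hence positive
  beyond x, and F increases from there. The positive weight c absorbs factors such as
  \<open>4 * sin t\<close>.\<close>

lemma single_crossing_antiderivative:
  assumes lim: "(F \<longlongrightarrow> 0) (at_right 0)"
    and der: "\<And>x. 0 < x \<Longrightarrow> x \<le> b \<Longrightarrow> (F has_real_derivative c x * G x) (at x)"
    and c: "\<And>x. 0 < x \<Longrightarrow> x \<le> b \<Longrightarrow> 0 < c x"
    and G: "single_crossing b G"
  shows "single_crossing b F"
  unfolding single_crossing_def
proof (intro allI impI, elim conjE)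
  fix x y assume xy: "0 < x" "x < y" "y \<le> b" "0 \<le> F x"
  have "\<exists>z. 0 < z \<and> z \<le> x \<and> 0 \<le> G z"
  proof (rule ccontr)
    assume "\<not> ?thesis"
    then have neg: "G z < 0" if "0 < z" "z \<le> x" for z
      using that by force
    have "0 < - F x"
    proof (rule pos_if_deriv_pos[where F = "\<lambda>x. - F x" and x = x and b = x])
      show "((\<lambda>x. - F x) \<longlongrightarrow> 0) (at_right 0)"
        using tendsto_minus[OF lim] by simp
      show "\<exists>D. ((\<lambda>x. - F x) has_real_derivative D) (at z) \<and> 0 < D" if "0 < z" "z \<le> x" for z
        using that xy neg[OF that] der[of z] c[of z]
        by (intro exI[of _ "- (c z * G z)"]) (auto intro!: DERIV_minus simp: mult_pos_neg)
    qed (use xy in auto)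
    with xy show False by simp
  qed
  then obtain z where z: "0 < z" "z \<le> x" "0 \<le> G z" by blast
  have "0 < G w" if "x < w" "w \<le> y" for w
  proof -
    have "z < w" "w \<le> b" using z xy that by linarith+
    with G z show ?thesis unfolding single_crossing_def by blast
  qed
  then have der_pos: "\<exists>D. (F has_real_derivative D) (at w) \<and> 0 < D" if "x < w" "w \<le> y" for w
    using that xy der[of w] c[of w] by (intro exI[of _ "c w * G w"]) auto
  \<comment> \<open>If z = x, then G may vanish at x, so the derivative is known to be positive only
    to the right of x. Continuity covers the endpoint.\<close>
  have "continuous_on {x..y} F"
    by (rule DERIV_atLeastAtMost_imp_continuous_on, rule exI, rule der) (use xy in auto)
  then have "F x < F y"
    by (intro DERIV_pos_imp_increasing_open[OF \<open>x < y\<close> der_pos]) simp_all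
  with xy show "0 < F y" by simp
qed

section \<open>The functions of the angle and their chain of derivatives\<close>

definition phi :: "real \<Rightarrow> real" where "phi t = ln (sin t / t)"

definition psi :: "real \<Rightarrow> real" where "psi t = t * cos t / sin t - 1"

text \<open>This is the derivative of \<open>phi - l * psi\<close> multiplied by
  \<open>t * (sin t)\<^sup>2\<close>. Clearing denominators makes it smooth at 0. In its second
  derivative the Pythagorean identity leaves the common factor \<open>4 * sin t\<close>, with
  cofactor \<open>q l t\<close>.\<close>

definition K :: "real \<Rightarrow> real \<Rightarrow> real" where
  "K l t = (1 - l) * t * sin t * cos t - (sin t)\<^sup>2 + l * t\<^sup>2"

definition K' :: "real \<Rightarrow> real \<Rightarrow> real" where
  "K' l t = (1 - l) * (sin t * cos t + t * ((cos t)\<^sup>2 - (sin t)\<^sup>2)) - 2 * sin t * cos t + 2 * l * t"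

definition q :: "real \<Rightarrow> real \<Rightarrow> real" where
  "q l t = l * sin t - (1 - l) * t * cos t"

definition q' :: "real \<Rightarrow> real \<Rightarrow> real" where
  "q' l t = (2 * l - 1) * cos t + (1 - l) * t * sin t"

lemma sin_pos_half_pi: "0 < sin t" if "0 < t" "t \<le> pi/2" for t :: real
  using that pi_gt_zero by (intro sin_gt_zero) linarith+

lemma has_derivative_chain:
  shows DERIV_q: "(q l has_real_derivative q' l t) (at t)"
    and DERIV_K': "(K' l has_real_derivative 4 * sin t * q l t) (at t)"
    and DERIV_K: "(K l has_real_derivative K' l t) (at t)"
    and DERIV_phi_psi: "0 < t \<Longrightarrow> t \<le> pi/2 \<Longrightarrow>
      ((\<lambda>t. phi t - l * psi t) has_real_derivative 1 / (t * (sin t)\<^sup>2) * K l t) (at t)"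
proof -
  show "(q l has_real_derivative q' l t) (at t)"
    unfolding q_def[abs_def] q'_def
    by (auto intro!: derivative_eq_intros simp: algebra_simps)
  have c: "(cos t)\<^sup>2 = 1 - (sin t)\<^sup>2" by (simp add: cos_squared_eq)
  show "(K' l has_real_derivative 4 * sin t * q l t) (at t)"
    unfolding q_def K'_def[abs_def]
    apply (rule derivative_eq_intros refl)+
    apply simp
    using c apply algebra
    done
  show "(K l has_real_derivative K' l t) (at t)"
    unfolding K_def[abs_def] K'_def
    by (auto intro!: derivative_eq_intros simp: algebra_simps power2_eq_square)
  assume t: "0 < t" "t \<le> pi/2"
  note s = sin_pos_half_pi[OF t]
  have "(phi has_real_derivative cos t / sin t - 1 / t) (at t)"
    unfolding phi_def[abs_def] using s t
    by (auto intro!: derivative_eq_intros simp: field_simps power2_eq_square)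
  moreover have "(psi has_real_derivative cos t / sin t - t / (sin t)\<^sup>2) (at t)"
    unfolding psi_def[abs_def] using s
    by (auto intro!: derivative_eq_intros simp: field_simps power2_eq_square)
      (metis distrib_left mult.right_neutral sin_cos_squared_add3)
  ultimately have "((\<lambda>t. phi t - l * psi t) has_real_derivative
      (cos t / sin t - 1 / t) - l * (cos t / sin t - t / (sin t)\<^sup>2)) (at t)"
    by (intro DERIV_diff DERIV_cmult)
  also have "(cos t / sin t - 1 / t) - l * (cos t / sin t - t / (sin t)\<^sup>2) = 1 / (t * (sin t)\<^sup>2) * K l t"
    using s t by (simp add: K_def field_simps power2_eq_square)
  finally show "((\<lambda>t. phi t - l * psi t) has_real_derivative 1 / (t * (sin t)\<^sup>2) * K l t) (at t)" .
qed

lemma tendsto_chain_0: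
  shows tendsto_q_0: "(q l \<longlongrightarrow> 0) (at_right 0)"
    and tendsto_K'_0: "(K' l \<longlongrightarrow> 0) (at_right 0)"
    and tendsto_K_0: "(K l \<longlongrightarrow> 0) (at_right 0)"
    and tendsto_phi_psi_0: "((\<lambda>t. phi t - l * psi t) \<longlongrightarrow> 0) (at_right 0)"
proof -
  have *: "(f \<longlongrightarrow> 0) (at_right 0)" if "isCont f 0" "f 0 = 0" for f :: "real \<Rightarrow> real"
    using that by (metis continuous_within filterlim_at_split isCont_def)
  show "(q l \<longlongrightarrow> 0) (at_right 0)" "(K' l \<longlongrightarrow> 0) (at_right 0)" "(K l \<longlongrightarrow> 0) (at_right 0)"
    by (intro *; auto intro: DERIV_isCont DERIV_q DERIV_K' DERIV_K simp: q_def K'_def K_def)+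
  have "((\<lambda>t. ln (sin t / t)) \<longlongrightarrow> 0) (at_right (0::real))"
    by real_asymp
  moreover have "((\<lambda>t. t * cos t / sin t - 1) \<longlongrightarrow> 0) (at_right (0::real))"
    by real_asymp
  ultimately have "((\<lambda>t. phi t - l * psi t) \<longlongrightarrow> 0 - l * 0) (at_right 0)"
    unfolding phi_def psi_def by (intro tendsto_intros)
  then show "((\<lambda>t. phi t - l * psi t) \<longlongrightarrow> 0) (at_right 0)"
    by simp
qed

section \<open>The lower bound, l = 1/2\<close>

lemma phi_gt_half_psi:
  assumes "0 < t" "t \<le> pi/2"
  shows "psi t / 2 < phi t"
proof -
  have s: "0 < sin u" if "0 < u" "u \<le> pi/2" for u :: real
    using sin_pos_half_pi that .
  \<comment> \<open>At l = 1/2 the cosine term of \<open>q'\<close> drops out and only t * sin t / 2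
    remains. Positivity then climbs through \<open>q\<close>, \<open>K'\<close> and \<open>K\<close>
    to \<open>phi - psi / 2\<close>.\<close>
  have q'_pos: "0 < q' (1/2) u" if "0 < u" "u \<le> pi/2" for u
    using s[OF that] that by (simp add: q'_def)
  have q_pos: "0 < q (1/2) u" if "0 < u" "u \<le> pi/2" for u
    by (rule pos_if_deriv_pos[OF tendsto_q_0 _ that]) (rule exI, rule conjI, rule DERIV_q, erule q'_pos)
  have K'_pos: "0 < K' (1/2) u" if "0 < u" "u \<le> pi/2" for u
    by (rule pos_if_deriv_pos[OF tendsto_K'_0 _ that])
      (rule exI, rule conjI, rule DERIV_K', intro mult_pos_pos q_pos s; simp)
  have K_pos: "0 < K (1/2) u" if "0 < u" "u \<le> pi/2" for u
    by (rule pos_if_deriv_pos[OF tendsto_K_0 _ that]) (rule exI, rule conjI, rule DERIV_K, erule K'_pos)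
  have "0 < phi t - 1/2 * psi t"
    by (rule pos_if_deriv_pos[OF tendsto_phi_psi_0 _ assms])
      (rule exI, rule conjI, rule DERIV_phi_psi, assumption+,
        intro mult_pos_pos divide_pos_pos zero_less_power K_pos s; simp)
  then show ?thesis by simp
qed

section \<open>Numerical bounds for ln(pi/2) and \<open>beta2\<close>\<close>

lemma ln_half_pi_bounds: "0.45156 < ln (pi/2)" "ln (pi/2) < 0.451588"
proof -
  have "ln (1.57079::real) \<le> ln (pi/2)" "ln (pi/2) \<le> ln (1.5708::real)"
    using pi_approx by (auto intro!: ln_mono)
  \<comment> \<open>By \<open>beta2_eq\<close>, 0.82335 < \<open>beta2\<close> < 0.82345 means that
    ln(pi/2) lies between about 0.451559 and 0.451589. The two bounds are chosen just inside this
    window.\<close>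
  moreover have "0.45156 < ln (1.57079::real)"
    using ln_approx_bounds[of "1.57079" 4] by (simp add: eval_nat_numeral)
  moreover have "ln (1.5708::real) < 0.451588"
    using ln_approx_bounds[of "1.5708" 4] by (simp add: eval_nat_numeral)
  ultimately show "0.45156 < ln (pi/2)" "ln (pi/2) < 0.451588" by linarith+
qed

lemma ln_half_pi_pos: "0 < ln (pi/2)"
  using pi_gt3 by (intro ln_gt_zero) simp

lemma ln_half_pi_less_half: "ln (pi/2) < 1/2"
  using ln_half_pi_bounds(2) by simp

lemma beta2_eq: "beta2 = ln (pi/2) / (1 - ln (pi/2))"
proof -
  have "ln (2 * exp 1 / pi) = 1 - ln (pi/2)"
    by (simp add: ln_div ln_mult)
  then show ?thesis by (simp add: beta2_def)
qed

lemma beta2_pos: "0 < beta2"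
  using ln_half_pi_pos ln_half_pi_less_half by (simp add: beta2_eq)

lemma beta2_ratio: "beta2 / (1 + beta2) = ln (pi/2)"
  using ln_half_pi_pos ln_half_pi_less_half by (simp add: beta2_eq divide_simps)

lemma beta2_approx: "\<bar>beta2 - 0.8234\<bar> < 0.00005"
proof -
  have "0.82335 < beta2" "beta2 < 0.82345"
    using ln_half_pi_bounds by (simp_all add: beta2_eq field_simps)
  then show ?thesis unfolding abs_less_iff by simp
qed

section \<open>The upper bound, l = ln(pi/2)\<close>

lemma phi_half_pi: "phi (pi/2) = - ln (pi/2)"
  by (simp add: phi_def ln_div)

lemma psi_half_pi: "psi (pi/2) = -1"
  by (simp add: psi_def)

lemma phi_less_psi:
  assumes "0 < t" "t < pi/2"
  shows "phi t < ln (pi/2) * psi t"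
proof -
  let ?L = "ln (pi/2)" and ?b = "pi/2"
  have L: "0 < ?L" "?L < 1/2"
    using ln_half_pi_pos ln_half_pi_less_half .
  \<comment> \<open>Since 2L - 1 < 0 < 1 - L, both terms of \<open>q'\<close> increase. A strictly
    increasing function starts the chain of single crossings.\<close>
  have "q' ?L x < q' ?L y" if "0 < x" "x < y" "y \<le> ?b" for x y
  proof -
    have "cos y < cos x" "sin x < sin y"
      using that by (auto intro: cos_monotone_0_pi sin_monotone_2pi)
    moreover have "0 < sin x" using that by (intro sin_pos_half_pi) auto
    ultimately have "(1 - 2 * ?L) * cos y < (1 - 2 * ?L) * cos x" "x * sin x < y * sin y"
      using that L by (auto intro!: mult_strict_mono)
    moreover from this(2) have "(1 - ?L) * (x * sin x) < (1 - ?L) * (y * sin y)"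
      using L by simp
    ultimately show ?thesis
      unfolding q'_def by (simp add: algebra_simps)
  qed
  then have "single_crossing ?b (q' ?L)"
    unfolding single_crossing_def by fastforce
  then have "single_crossing ?b (q ?L)"
    by (intro single_crossing_antiderivative[where c = "\<lambda>_. 1", OF tendsto_q_0]) (auto intro: DERIV_q)
  then have "single_crossing ?b (K' ?L)"
    by (intro single_crossing_antiderivative[OF tendsto_K'_0 DERIV_K']) (auto intro: sin_pos_half_pi)
  then have "single_crossing ?b (K ?L)"
    by (intro single_crossing_antiderivative[where c = "\<lambda>_. 1", OF tendsto_K_0]) (auto intro: DERIV_K)
  then have "single_crossing ?b (\<lambda>t. phi t - ?L * psi t)"
    using sin_pos_half_pi
    by (intro single_crossing_antiderivative[OF tendsto_phi_psi_0 DERIV_phi_psi]) force+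
  moreover have "phi ?b - ?L * psi ?b = 0"
    by (simp add: phi_half_pi psi_half_pi)
  \<comment> \<open>\<open>single_crossing\<close> admits y = b, so a nonnegative value at t would
    make the value at pi/2 strictly positive.\<close>
  ultimately have "\<not> 0 \<le> phi t - ?L * psi t"
    using assms unfolding single_crossing_def by (metis order.refl less_irrefl)
  then show ?thesis by simp
qed

section \<open>The means in terms of the angle\<close>

lemma A_mean_pos: "0 < a \<Longrightarrow> 0 < b \<Longrightarrow> 0 < A_mean a b"
  by (simp add: A_mean_def)

text \<open>As arcsin is odd, P is symmetric and a - b may be replaced by its absolute value, which
  gives P = A * sin t / t. From (a + b)^2 - (a - b)^2 = 4ab one gets G = A * cos t, hence G/P = t *
  cot t.\<close>

lemma means_eq_exp:
  assumes "0 < a" "0 < b" "0 < t" "t < pi/2" and sin_t: "sin t = \<bar>a - b\<bar> / (a + b)"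
  shows "P_mean a b = A_mean a b * exp (phi t)" "X_mean a b = A_mean a b * exp (psi t)"
proof -
  have s: "0 < sin t" and c: "0 < cos t"
    using sin_pos_half_pi[of t] cos_gt_zero[of t] assms(3,4) by simp_all
  have "P_mean a b = \<bar>a - b\<bar> / (2 * arcsin (\<bar>a - b\<bar> / (a + b)))"
  proof (cases "b \<le> a")
    case False
    have "(a - b) / (a + b) = - ((b - a) / (a + b))" by (simp add: minus_divide_left)
    moreover have "(b - a) / (a + b) \<in> {-1..1}"
      using assms by (auto simp: divide_simps)
    ultimately have "arcsin ((a - b) / (a + b)) = - arcsin ((b - a) / (a + b))"
      by (simp add: arcsin_minus)
    with False show ?thesis by (simp add: P_mean_def minus_divide_left)
  qed (simp add: P_mean_def)
  also have "arcsin (\<bar>a - b\<bar> / (a + b)) = t"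
    using assms by (simp flip: sin_t add: arcsin_sin)
  also have "\<bar>a - b\<bar> = (a + b) * sin t"
    using assms by simp
  finally have P: "P_mean a b = A_mean a b * (sin t / t)"
    by (simp add: A_mean_def)
  have "exp (phi t) = sin t / t"
    using s \<open>0 < t\<close> by (simp add: phi_def)
  with P show "P_mean a b = A_mean a b * exp (phi t)" by simp
  have "(cos t)\<^sup>2 = 1 - ((a - b) / (a + b))\<^sup>2"
    by (simp add: cos_squared_eq sin_t power_divide)
  also have "\<dots> = ((a + b)\<^sup>2 - (a - b)\<^sup>2) / (a + b)\<^sup>2"
    using assms(1,2) by (simp add: power_divide diff_divide_distrib[of "(a + b)\<^sup>2"])
  also have "(a + b)\<^sup>2 - (a - b)\<^sup>2 = 4 * (a * b)"
    by algebra
  also have "4 * (a * b) / (a + b)\<^sup>2 = (a * b) / (A_mean a b)\<^sup>2"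
    by (simp add: A_mean_def power_divide)
  finally have "a * b = (A_mean a b * cos t)\<^sup>2"
    using assms A_mean_pos[of a b] by (simp add: power_mult_distrib)
  then have G: "G_mean a b = A_mean a b * cos t"
    using assms c A_mean_pos[of a b] by (simp add: G_mean_def)
  have "G_mean a b / P_mean a b = t * cos t / sin t"
    unfolding G P using A_mean_pos[OF assms(1,2)] by simp
  then show "X_mean a b = A_mean a b * exp (psi t)"
    by (simp add: X_mean_def psi_def)
qed

lemma means_angle_exists:
  assumes "0 < a" "0 < b" "a \<noteq> b"
  obtains t where "0 < t" "t < pi/2" "sin t = \<bar>a - b\<bar> / (a + b)"
proof -
  let ?v = "\<bar>a - b\<bar> / (a + b)"
  have v: "0 < ?v" "?v < 1" using assms by (auto simp: divide_simps)
  show ?thesis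
  proof (rule that)
    show "sin (arcsin ?v) = ?v" using v by (intro sin_arcsin) auto
    show "0 < arcsin ?v" using arcsin_less_arcsin[of 0 ?v] v by simp
    show "arcsin ?v < pi/2" using arcsin_less_arcsin[of ?v 1] v by simp
  qed
qed

text \<open>On logarithms: (ln A + p (ln A + m)) / (1 + p) = ln A + p m / (1 + p). The case p = 1
  serves the left inequality, p = \<open>beta2\<close> the right one.\<close>

lemma weighted_geometric_mean_exp:
  fixes A p m :: real
  assumes "0 < A" "0 < 1 + p"
  shows "(A * (A * exp m) powr p) powr (1 / (1 + p)) = A * exp (p / (1 + p) * m)"
proof -
  have "ln ((A * (A * exp m) powr p) powr (1 / (1 + p))) = ln (A * exp (p / (1 + p) * m))"
    using assms by (simp add: ln_mult ln_powr field_simps)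
  then show ?thesis
    using assms by (subst (asm) ln_inj_iff) auto
qed

lemma means_scale:
  assumes "0 < s" "0 < a" "0 < b"
  shows "A_mean (s * a) (s * b) = s * A_mean a b" "P_mean (s * a) (s * b) = s * P_mean a b"
    "X_mean (s * a) (s * b) = s * X_mean a b"
proof -
  show A: "A_mean (s * a) (s * b) = s * A_mean a b"
    by (simp add: A_mean_def distrib_left)
  have "(s * a - s * b) / (s * a + s * b) = (a - b) / (a + b)"
    using assms by (simp flip: distrib_left right_diff_distrib)
  then show P: "P_mean (s * a) (s * b) = s * P_mean a b"
    by (simp add: P_mean_def right_diff_distrib)
  have "s * a * (s * b) = s\<^sup>2 * (a * b)" by (simp add: power2_eq_square)
  then have "G_mean (s * a) (s * b) = s * G_mean a b"
    using assms by (simp add: G_mean_def real_sqrt_mult)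
  with A P assms show "X_mean (s * a) (s * b) = s * X_mean a b"
    by (simp add: X_mean_def)
qed

lemma two_sided_inequality:
  assumes "0 < a" "0 < b" "a \<noteq> b"
  shows "(A_mean a b * X_mean a b) powr (1 / alpha2) < P_mean a b"
    and "P_mean a b < (A_mean a b * X_mean a b powr beta2) powr (1 / (1 + beta2))"
proof -
  obtain t where t: "0 < t" "t < pi/2" "sin t = \<bar>a - b\<bar> / (a + b)"
    using means_angle_exists[OF assms] .
  note eqs = means_eq_exp[OF assms(1,2) t]
  note A = A_mean_pos[OF assms(1,2)]
  have "(A_mean a b * X_mean a b) powr (1 / alpha2) = A_mean a b * exp (psi t / 2)"
    using weighted_geometric_mean_exp[of "A_mean a b" 1 "psi t"] A by (simp add: eqs alpha2_def)
  with phi_gt_half_psi[of t] t A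
  show "(A_mean a b * X_mean a b) powr (1 / alpha2) < P_mean a b"
    by (simp add: eqs)
  show "P_mean a b < (A_mean a b * X_mean a b powr beta2) powr (1 / (1 + beta2))"
    using A beta2_pos phi_less_psi[OF t(1,2)]
    by (simp add: eqs weighted_geometric_mean_exp beta2_ratio)
qed

section \<open>Sharpness of the constants\<close>

lemma alpha2_optimal:
  assumes "0 < \<alpha>" "\<alpha> \<noteq> alpha2"
  shows "\<exists>a b. 0 < a \<and> 0 < b \<and> a \<noteq> b \<and> P_mean a b \<le> (A_mean a b * X_mean a b) powr (1 / \<alpha>)"
proof -
  define M where "M = (A_mean 3 1 * X_mean 3 1) powr (1 / \<alpha>)"
  define e where "e = 2 / \<alpha> - 1"
  \<comment> \<open>The pair (3, 1) is arbitrary. Scaling it by s multiplies P by s and the left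
    side by s^(2/\<alpha>). Here s solves s^e * M = P(3, 1), so both sides agree at (3s, s) and the
    strict inequality fails.\<close>
  define s where "s = (P_mean 3 1 / M) powr (1 / e)"
  have e: "e \<noteq> 0" using assms by (simp add: e_def alpha2_def)
  obtain t where t: "0 < t" "t < pi/2" "sin t = \<bar>3 - 1\<bar> / (3 + 1)"
    using means_angle_exists[of 3 1] by auto
  note eqs = means_eq_exp[OF _ _ t, simplified]
  have A: "0 < A_mean 3 1" by (simp add: A_mean_pos)
  have pos: "0 < M" "0 < P_mean 3 1" "0 < X_mean 3 1"
    using A by (simp_all add: M_def eqs)
  then have s: "0 < s" by (simp add: s_def)
  have "(A_mean (s * 3) (s * 1) * X_mean (s * 3) (s * 1)) powr (1 / \<alpha>)
      = (s powr 2 * (A_mean 3 1 * X_mean 3 1)) powr (1 / \<alpha>)"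
    using s by (simp only: means_scale) (simp add: powr_numeral power2_eq_square mult_ac)
  also have "\<dots> = s powr (2 / \<alpha>) * M"
    using s A pos by (simp add: powr_mult powr_powr M_def del: powr_numeral)
  also have "s powr (2 / \<alpha>) = s * s powr e"
    using s by (simp add: e_def powr_diff)
  also have "s powr e = P_mean 3 1 / M"
    using pos e by (simp add: s_def powr_powr)
  also have "s * (P_mean 3 1 / M) * M = P_mean (s * 3) (s * 1)"
    using pos s by (simp only: means_scale) simp
  finally show ?thesis
    using s by (intro exI[of _ "s * 3"] exI[of _ "s * 1"]) simp
qed

lemma beta2_optimal:
  assumes "beta2 < \<beta>"
  shows "\<exists>a b. 0 < a \<and> 0 < b \<and> a \<noteq> b \<and>
    (A_mean a b * X_mean a b powr \<beta>) powr (1 / (1 + \<beta>)) \<le> P_mean a b"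
proof -
  define m where "m = \<beta> / (1 + \<beta>)"
  have \<beta>: "0 < \<beta>" using assms beta2_pos by simp
  \<comment> \<open>The map p / (1 + p) is increasing. So m exceeds ln(pi/2), and
    \<open>phi - m * psi\<close> has the positive value m - ln(pi/2) at pi/2. Continuity gives some
    t < pi/2; the endpoint itself would correspond to b = 0.\<close>
  have "beta2 / (1 + beta2) < m"
    using assms beta2_pos by (simp add: m_def field_simps)
  then have gt: "ln (pi/2) < m" by (simp add: beta2_ratio)
  have "isCont (\<lambda>t. phi t - m * psi t) (pi/2)"
    by (rule DERIV_isCont[OF DERIV_phi_psi]) auto
  moreover have "0 < phi (pi/2) - m * psi (pi/2)"
    using gt by (simp add: phi_half_pi psi_half_pi)
  ultimately have "eventually (\<lambda>t. 0 < phi t - m * psi t) (at (pi/2))"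
    by (intro order_tendstoD) (auto simp: isCont_def)
  then have "eventually (\<lambda>t. 0 < phi t - m * psi t) (at_left (pi/2))"
    by (simp add: eventually_at_split)
  moreover have "eventually (\<lambda>t. t \<in> {0<..<pi/2}) (at_left (pi/2))"
    by (intro eventually_at_left_real) auto
  ultimately have "eventually (\<lambda>t. 0 < t \<and> t < pi/2 \<and> m * psi t < phi t) (at_left (pi/2))"
    by eventually_elim auto
  then obtain t where t: "0 < t" "t < pi/2" "m * psi t < phi t"
    using eventually_happens[of _ "at_left (pi/2)"] by auto
  \<comment> \<open>The sum is 2 and the difference 2 * sin t, so this pair has exactly the angle
    t.\<close>
  let ?a = "1 + sin t" and ?b = "1 - sin t"
  have s: "0 < sin t" "sin t < 1"
    using t sin_monotone_2pi[of t "pi/2"] by (auto intro: sin_pos_half_pi)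
  have ab: "0 < ?a" "0 < ?b" "?a \<noteq> ?b" using s by auto
  have "sin t = \<bar>?a - ?b\<bar> / (?a + ?b)" using s by simp
  note eqs = means_eq_exp[OF ab(1,2) t(1,2) this]
  have "(A_mean ?a ?b * X_mean ?a ?b powr \<beta>) powr (1 / (1 + \<beta>)) = A_mean ?a ?b * exp (m * psi t)"
    using \<beta> ab by (simp only: eqs) (simp add: weighted_geometric_mean_exp A_mean_pos m_def)
  also have "\<dots> \<le> P_mean ?a ?b"
    using t A_mean_pos[OF ab(1,2)] by (simp only: eqs) simp
  finally show ?thesis using ab by blast
qed

theorem theorem2p25:
  "(\<forall>a b :: real. a > 0 \<and> b > 0 \<and> a \<noteq> b \<longrightarrow>
      (A_mean a b * X_mean a b) powr (1 / alpha2) < P_mean a b \<and>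
      P_mean a b < (A_mean a b * X_mean a b powr beta2) powr (1 / (1 + beta2))) \<and>
   (\<forall>\<alpha> :: real. \<alpha> > 0 \<and> \<alpha> \<noteq> alpha2 \<longrightarrow>
      \<not> (\<forall>a b :: real. a > 0 \<and> b > 0 \<and> a \<noteq> b \<longrightarrow>
           (A_mean a b * X_mean a b) powr (1 / \<alpha>) < P_mean a b)) \<and>
   (\<forall>\<beta> :: real. \<beta> > beta2 \<longrightarrow>
      \<not> (\<forall>a b :: real. a > 0 \<and> b > 0 \<and> a \<noteq> b \<longrightarrow>
           P_mean a b < (A_mean a b * X_mean a b powr \<beta>) powr (1 / (1 + \<beta>)))) \<and>
   \<bar>beta2 - 0.8234\<bar> < 0.00005"
proof (intro conjI allI impI)
  show "\<bar>beta2 - 0.8234\<bar> < 0.00005" by (rule beta2_approx)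
next
  fix \<alpha> :: real
  assume "\<alpha> > 0 \<and> \<alpha> \<noteq> alpha2"
  then show "\<not> (\<forall>a b :: real. a > 0 \<and> b > 0 \<and> a \<noteq> b \<longrightarrow>
      (A_mean a b * X_mean a b) powr (1 / \<alpha>) < P_mean a b)"
    using alpha2_optimal[of \<alpha>] by (meson not_le)
next
  fix \<beta> :: real
  assume "\<beta> > beta2"
  then show "\<not> (\<forall>a b :: real. a > 0 \<and> b > 0 \<and> a \<noteq> b \<longrightarrow>
      P_mean a b < (A_mean a b * X_mean a b powr \<beta>) powr (1 / (1 + \<beta>)))"
    using beta2_optimal[of \<beta>] by (meson not_le)
qed (simp_all add: two_sided_inequality)

end
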